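(* Let $A$ be a finite-dimensional algebra over a field $F$ and let $\{e_i \mid 1 \le i \le \ell(A)\}$ be a basic set of primitive idempotents of $A$. Then for every integer $n \ge 1$, $$\operatorname{codim} KR^n(A) \le \sum_{1 \le i \le \ell(A)} \dim e_i A e_i / e_i \operatorname{Rad}^n(A) e_i .$$ Furthermore, if equality holds for some $n$, then equality holds with $n$ replaced by $m$ for every $1 \le m \le n$; and if equality does not hold for some $n$, then it does not hold with $n$ replaced by $m$ for every $m \ge n$.
   Context: Algebras are associative and unital; dimensions are over $F$ and codimensions are those of $F$-subspaces of $A$. $K(A)$ denotes the commutator subspace of $A$, i.e. the $F$-subspace of $A$ spanned by all $xy - yx$ with $x, y \in A$; $\operatorname{Rad}^n(A)$ is the $n$th power of the Jacobson radical of $A$; and $KR^n(A) := K(A) + \operatorname{Rad}^n(A)$. $\ell(A)$ is the number of isomorphism classes of simple right $A$-modules. A basic set of primitive idempotents of $A$ is a set of pairwise orthogonal primitive idempotents $e_1, \dots, e_{\ell(A)}$ such that $e_1A, \dots, e_{\ell(A)}A$ is a complete irredundant set of representatives of the isomorphism classes of indecomposable projective right $A$-modules. *)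

theory Defs
  imports Complex_Main "HOL-Algebra.Ring"
begin

text \<open>
  The ambient ring of an algebra is a type of sort \<open>{ring, monoid_mult}\<close>, i.e. an associative
  unital ring. The class \<open>ring_1\<close> is not used because it excludes the zero ring.
\<close>

locale fd_algebra = vector_space scale
  for scale :: "'f::field \<Rightarrow> 'a::{ring,monoid_mult} \<Rightarrow> 'a" +
  assumes scale_mult_left: "scale c x * y = scale c (x * y)"
    and scale_mult_right: "x * scale c y = scale c (x * y)"
    and finite_dimensional: "\<exists>B. finite B \<and> span B = UNIV"


section \<open>Right modules\<close>

text \<open>
  As for the modules of HOL-Algebra, the additive group is carried by the \<open>add\<close> and \<open>zero\<close>
  fields of a ring record, whose fields \<open>mult\<close> and \<open>one\<close> are irrelevant.
\<close>

record ('a, 'm) right_module = "'m Ring.ring" +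
  act :: "'m \<Rightarrow> 'a \<Rightarrow> 'm"

locale right_module = abelian_group M
  for M :: "('a::{ring,monoid_mult}, 'm) right_module" (structure) +
  assumes act_closed: "x \<in> carrier M \<Longrightarrow> act M x a \<in> carrier M"
    and act_add_left: "x \<in> carrier M \<Longrightarrow> y \<in> carrier M \<Longrightarrow>
      act M (x \<oplus> y) a = act M x a \<oplus> act M y a"
    and act_add_right: "x \<in> carrier M \<Longrightarrow> act M x (a + b) = act M x a \<oplus> act M x b"
    and act_mult: "x \<in> carrier M \<Longrightarrow> act M x (a * b) = act M (act M x a) b"
    and act_one: "x \<in> carrier M \<Longrightarrow> act M x 1 = x"

definition submodule :: "'m set \<Rightarrow> ('a::{ring,monoid_mult}, 'm) right_module \<Rightarrow> bool" where
  "submodule N M \<longleftrightarrow> N \<subseteq> carrier M \<and> right_module (M\<lparr>carrier := N\<rparr>)"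

definition right_module_hom ::
  "('a::{ring,monoid_mult}, 'm) right_module \<Rightarrow> ('a, 'n) right_module \<Rightarrow> ('m \<Rightarrow> 'n) set" where
  "right_module_hom M N = {f \<in> carrier M \<rightarrow> carrier N.
     (\<forall>x\<in>carrier M. \<forall>y\<in>carrier M. f (x \<oplus>\<^bsub>M\<^esub> y) = f x \<oplus>\<^bsub>N\<^esub> f y) \<and>
     (\<forall>x\<in>carrier M. \<forall>a. f (act M x a) = act N (f x) a)}"

definition right_module_iso ::
  "('a::{ring,monoid_mult}, 'm) right_module \<Rightarrow> ('a, 'n) right_module \<Rightarrow> bool" where
  "right_module_iso M N \<longleftrightarrow> (\<exists>f\<in>right_module_hom M N. bij_betw f (carrier M) (carrier N))"

definition simple_module :: "('a::{ring,monoid_mult}, 'm) right_module \<Rightarrow> bool" where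
  "simple_module M \<longleftrightarrow> right_module M \<and> carrier M \<noteq> {\<zero>\<^bsub>M\<^esub>} \<and>
     (\<forall>N. submodule N M \<longrightarrow> N = {\<zero>\<^bsub>M\<^esub>} \<or> N = carrier M)"

definition indecomposable_module :: "('a::{ring,monoid_mult}, 'm) right_module \<Rightarrow> bool" where
  "indecomposable_module M \<longleftrightarrow> right_module M \<and> carrier M \<noteq> {\<zero>\<^bsub>M\<^esub>} \<and>
     (\<forall>N L. submodule N M \<and> submodule L M \<and> N \<inter> L = {\<zero>\<^bsub>M\<^esub>} \<and>
        carrier M = {x \<oplus>\<^bsub>M\<^esub> y |x y. x \<in> N \<and> y \<in> L} \<longrightarrow>
        N = {\<zero>\<^bsub>M\<^esub>} \<or> L = {\<zero>\<^bsub>M\<^esub>})"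

text \<open>
  HOL cannot quantify over modules carried by arbitrary types, so such quantifiers range over the
  modules whose elements have the following type. Up to isomorphism these include every finitely
  generated right module over \<open>'a\<close>, since the elements of a quotient of \<open>A\<^sup>k\<close> are sets of
  \<open>k\<close>-tuples; in particular all simple modules, and, when \<open>'a\<close> is a finite-dimensional algebra,
  all indecomposable projective ones.
\<close>

type_synonym 'a module_universe = "(nat \<Rightarrow> 'a) set"

text \<open>
  The test modules range over the same universe. This loses nothing for a module \<open>P\<close> of cardinality
  at most that of the universe: the free module on the set \<open>P\<close> again fits into the universe (which
  is infinite unless \<open>'a\<close> is the zero ring), so its canonical map onto \<open>P\<close> splits.
\<close>

definition projective_module :: "('a::{ring,monoid_mult}, 'm) right_module \<Rightarrow> bool" where
  "projective_module P \<longleftrightarrow> right_module P \<and>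
     (\<forall>(M :: ('a, 'a module_universe) right_module) (N :: ('a, 'a module_universe) right_module) g f.
        right_module M \<and> right_module N \<and> g \<in> right_module_hom M N \<and> g ` carrier M = carrier N \<and>
        f \<in> right_module_hom P N \<longrightarrow>
        (\<exists>h\<in>right_module_hom P M. \<forall>x\<in>carrier P. g (h x) = f x))"

definition num_simple_modules :: "'a::{ring,monoid_mult} itself \<Rightarrow> nat" where
  "num_simple_modules _ =
     card ({M :: ('a, 'a module_universe) right_module. simple_module M} //
           {(M, N). simple_module M \<and> simple_module N \<and> right_module_iso M N})"

definition regular_module :: "('a::{ring,monoid_mult}, 'a) right_module" where
  "regular_module = \<lparr>carrier = UNIV, mult = (*), one = 1, zero = 0, add = (+), act = (*)\<rparr>"

definition principal_right_ideal :: "'a::{ring,monoid_mult} \<Rightarrow> ('a, 'a) right_module" where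
  "principal_right_ideal e = regular_module\<lparr>carrier := range ((*) e)\<rparr>"


section \<open>Basic sets of primitive idempotents\<close>

definition primitive_idempotent :: "'a::{ring,monoid_mult} \<Rightarrow> bool" where
  "primitive_idempotent e \<longleftrightarrow> e * e = e \<and> e \<noteq> 0 \<and>
     (\<forall>f g. f * f = f \<and> g * g = g \<and> f * g = 0 \<and> g * f = 0 \<and> e = f + g \<longrightarrow> f = 0 \<or> g = 0)"

definition basic_set :: "(nat \<Rightarrow> 'a::{ring,monoid_mult}) \<Rightarrow> bool" where
  "basic_set e \<longleftrightarrow> (let I = {1..num_simple_modules TYPE('a)} in
     (\<forall>i\<in>I. primitive_idempotent (e i)) \<and>
     (\<forall>i\<in>I. \<forall>j\<in>I. i \<noteq> j \<longrightarrow> e i * e j = 0) \<and>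
     (\<forall>i\<in>I. indecomposable_module (principal_right_ideal (e i)) \<and>
            projective_module (principal_right_ideal (e i))) \<and>
     (\<forall>P :: ('a, 'a module_universe) right_module.
        indecomposable_module P \<and> projective_module P \<longrightarrow>
        (\<exists>i\<in>I. right_module_iso P (principal_right_ideal (e i)))) \<and>
     (\<forall>i\<in>I. \<forall>j\<in>I. i \<noteq> j \<longrightarrow>
        \<not> right_module_iso (principal_right_ideal (e i)) (principal_right_ideal (e j))))"


section \<open>Radical powers, commutators and codimensions\<close>

definition maximal_right_ideal :: "'a::{ring,monoid_mult} set \<Rightarrow> bool" where
  "maximal_right_ideal I \<longleftrightarrow> submodule I regular_module \<and> I \<noteq> UNIV \<and>
     (\<forall>J. submodule J regular_module \<and> I \<subseteq> J \<longrightarrow> J = I \<or> J = UNIV)"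

definition jacobson_radical :: "'a::{ring,monoid_mult} set" where
  "jacobson_radical = \<Inter>{I. maximal_right_ideal I}"

text \<open>
  Ideals of a unital algebra are subspaces, so the linear span of the products \<open>x * y\<close> below is
  the set of their finite sums.
\<close>

primrec radical_power :: "('f::field \<Rightarrow> 'a::{ring,monoid_mult} \<Rightarrow> 'a) \<Rightarrow> nat \<Rightarrow> 'a set" where
  "radical_power scale 0 = UNIV"
| "radical_power scale (Suc n) =
     module.span scale {x * y |x y. x \<in> jacobson_radical \<and> y \<in> radical_power scale n}"

definition commutator_space :: "('f::field \<Rightarrow> 'a::{ring,monoid_mult} \<Rightarrow> 'a) \<Rightarrow> 'a set" where
  "commutator_space scale = module.span scale {x * y - y * x |x y. True}"

definition KR :: "('f::field \<Rightarrow> 'a::{ring,monoid_mult} \<Rightarrow> 'a) \<Rightarrow> nat \<Rightarrow> 'a set" where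
  "KR scale n = {x + y |x y. x \<in> commutator_space scale \<and> y \<in> radical_power scale n}"

text \<open>
  A basis of the quotient space \<open>V/W\<close>, given by representatives: every class is a unique linear
  combination of the classes of the elements of \<open>B\<close>. The side condition on \<open>c\<close> only pins down
  the coefficient function outside \<open>B\<close>.
\<close>

definition quotient_basis ::
  "('f::field \<Rightarrow> 'a::ab_group_add \<Rightarrow> 'a) \<Rightarrow> 'a set \<Rightarrow> 'a set \<Rightarrow> 'a set \<Rightarrow> bool" where
  "quotient_basis scale V W B \<longleftrightarrow> finite B \<and> B \<subseteq> V \<and>
     (\<forall>v\<in>V. \<exists>!c. (\<forall>b. b \<notin> B \<longrightarrow> c b = 0) \<and> v - (\<Sum>b\<in>B. scale (c b) b) \<in> W)"

definition quotient_dim ::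
  "('f::field \<Rightarrow> 'a::ab_group_add \<Rightarrow> 'a) \<Rightarrow> 'a set \<Rightarrow> 'a set \<Rightarrow> nat" where
  "quotient_dim scale V W = card (SOME B. quotient_basis scale V W B)"

definition codim :: "('f::field \<Rightarrow> 'a::ab_group_add \<Rightarrow> 'a) \<Rightarrow> 'a set \<Rightarrow> nat" where
  "codim scale W = quotient_dim scale UNIV W"

definition corner :: "'a::{ring,monoid_mult} \<Rightarrow> 'a set \<Rightarrow> 'a set" where
  "corner e V = {e * x * e |x. x \<in> V}"

definition corner_dim_sum ::
  "('f::field \<Rightarrow> 'a::{ring,monoid_mult} \<Rightarrow> 'a) \<Rightarrow> (nat \<Rightarrow> 'a) \<Rightarrow> nat \<Rightarrow> nat" where
  "corner_dim_sum scale e n =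
     (\<Sum>i = 1..num_simple_modules TYPE('a).
        quotient_dim scale (corner (e i) UNIV) (corner (e i) (radical_power scale n)))"

end

theory Submission
  imports Defs
begin

text \<open>
  Let \<open>\<pi> x = (\<Sum>i. e\<^sub>i x e\<^sub>i)\<close> and let \<open>C\<close> be its range. Every two-sided ideal \<open>I\<close> lies in
  \<open>K(A) + \<pi>(I)\<close>: an off-diagonal Peirce component \<open>g x h\<close> is the commutator of \<open>g\<close> and \<open>x h\<close>, and
  if \<open>f A\<close> is isomorphic to \<open>e\<^sub>i A\<close> via \<open>a b = e\<^sub>i\<close> and \<open>b a = f\<close>, then \<open>f x f\<close> and \<open>a x b\<close> differ
  by a commutator. For \<open>I = A\<close> this gives \<open>codim KR\<^sup>n(A) = dim C - dim (KR\<^sup>n(A) \<inter> C)\<close>, while the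
  right-hand side of the theorem is \<open>dim C - dim \<pi>(Rad\<^sup>n(A))\<close>, and \<open>\<pi>(Rad\<^sup>n(A))\<close> lies in
  \<open>KR\<^sup>n(A) \<inter> C\<close>. Hence equality holds iff \<open>KR\<^sup>n(A) \<inter> C \<subseteq> Rad\<^sup>n(A)\<close>. This condition passes
  from \<open>n\<close> to \<open>m \<le> n\<close>: applied to \<open>I = Rad\<^sup>m(A)\<close>, the decomposition moves an element of
  \<open>KR\<^sup>m(A) \<inter> C\<close> modulo \<open>\<pi>(Rad\<^sup>m(A))\<close> into \<open>K(A) \<inter> C\<close>, which lies in \<open>Rad\<^sup>n(A)\<close>.
\<close>


section \<open>Submodules and principal right ideals\<close>

lemma submoduleD:
  assumes "submodule N M"
  shows "N \<subseteq> carrier M" and "\<zero>\<^bsub>M\<^esub> \<in> N"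
    and "x \<in> N \<Longrightarrow> y \<in> N \<Longrightarrow> x \<oplus>\<^bsub>M\<^esub> y \<in> N"
    and "x \<in> N \<Longrightarrow> act M x a \<in> N"
proof -
  from assms interpret N: right_module "M\<lparr>carrier := N\<rparr>"
    by (simp add: submodule_def)
  show "N \<subseteq> carrier M"
    using assms by (simp add: submodule_def)
  show "\<zero>\<^bsub>M\<^esub> \<in> N"
    using N.zero_closed by simp
  show "x \<in> N \<Longrightarrow> y \<in> N \<Longrightarrow> x \<oplus>\<^bsub>M\<^esub> y \<in> N"
    using N.add.m_closed by simp
  show "x \<in> N \<Longrightarrow> act M x a \<in> N"
    using N.act_closed by simp
qed

lemma regular_module_simps [simp]:
  "carrier regular_module = UNIV" "\<zero>\<^bsub>regular_module\<^esub> = 0"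
  "x \<oplus>\<^bsub>regular_module\<^esub> y = x + y" "act regular_module x a = x * a"
  by (simp_all add: regular_module_def)

lemma principal_right_ideal_simps [simp]:
  "carrier (principal_right_ideal f) = range ((*) f)"
  "\<zero>\<^bsub>principal_right_ideal f\<^esub> = 0"
  "x \<oplus>\<^bsub>principal_right_ideal f\<^esub> y = x + y"
  "act (principal_right_ideal f) x a = x * a"
  by (simp_all add: principal_right_ideal_def regular_module_def)

text \<open>Negation is right multiplication by \<open>- 1\<close>, so closure under sums and the
  action already gives a subgroup.\<close>

lemma submodule_regular_iff:
  "submodule I regular_module \<longleftrightarrow>
    0 \<in> I \<and> (\<forall>x\<in>I. \<forall>y\<in>I. x + y \<in> I) \<and> (\<forall>x\<in>I. \<forall>a. x * a \<in> I)"
  (is "_ \<longleftrightarrow> ?R")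
proof
  assume "submodule I regular_module"
  from submoduleD[OF this] show ?R by simp
next
  assume R: ?R
  have neg: "- x \<in> I" if "x \<in> I" for x
  proof -
    have "x * (- 1) \<in> I" using R that by blast
    then show ?thesis by simp
  qed
  have "abelian_group (regular_module\<lparr>carrier := I\<rparr>)"
    by (rule abelian_groupI) (use R neg in \<open>auto simp: algebra_simps intro!: bexI[of _ "- _"]\<close>)
  then have "right_module (regular_module\<lparr>carrier := I\<rparr>)"
    unfolding right_module_def right_module_axioms_def
    using R by (auto simp: algebra_simps)
  then show "submodule I regular_module"
    by (simp add: submodule_def)
qed

section \<open>Copies of principal right ideals in the module universe\<close>

definition to_universe :: "'a \<Rightarrow> 'a module_universe" where
  "to_universe x = {\<lambda>_. x}"

text \<open>Left inverse of \<open>to_universe\<close>; the sequence stored there is constant, so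
  evaluation at any index would serve.\<close>

definition of_universe :: "'a module_universe \<Rightarrow> 'a" where
  "of_universe S = the_elem S 0"

lemma of_to_universe [simp]: "of_universe (to_universe x) = x"
  by (simp add: to_universe_def of_universe_def)

lemma to_universe_eq_iff [simp]: "to_universe x = to_universe y \<longleftrightarrow> x = y"
  by (metis of_to_universe)

text \<open>
  An isomorphic copy of \<open>f A\<close> inside the universe over which \<open>basic_set\<close> quantifies.
\<close>

definition principal_copy ::
  "'a::{ring,monoid_mult} \<Rightarrow> ('a, 'a module_universe) right_module" where
  "principal_copy f = \<lparr>carrier = to_universe ` range ((*) f), mult = (\<lambda>x y. x), one = to_universe 0,
     zero = to_universe 0, add = (\<lambda>x y. to_universe (of_universe x + of_universe y)),
     act = (\<lambda>x a. to_universe (of_universe x * a))\<rparr>"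

lemma principal_copy_simps [simp]:
  "carrier (principal_copy f) = to_universe ` range ((*) f)"
  "\<zero>\<^bsub>principal_copy f\<^esub> = to_universe 0"
  "x \<oplus>\<^bsub>principal_copy f\<^esub> y = to_universe (of_universe x + of_universe y)"
  "act (principal_copy f) x a = to_universe (of_universe x * a)"
  by (simp_all add: principal_copy_def)

lemma right_module_principal_copy:
  fixes f :: "'a::{ring,monoid_mult}"
  shows "right_module (principal_copy f)"
proof -
  have "abelian_group (principal_copy f)"
  proof (rule abelian_groupI)
    fix x assume "x \<in> carrier (principal_copy f)"
    then obtain a where "x = to_universe (f * a)" by auto
    then show "\<exists>y\<in>carrier (principal_copy f). y \<oplus>\<^bsub>principal_copy f\<^esub> x = \<zero>\<^bsub>principal_copy f\<^esub>"
      by (intro bexI[of _ "to_universe (f * (- a))"]) (simp_all del: mult_minus_right flip: distrib_left)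
  next
    show "\<zero>\<^bsub>principal_copy f\<^esub> \<in> carrier (principal_copy f)"
      by (auto intro!: image_eqI[of _ to_universe 0] image_eqI[of _ _ "0::'a"])
  next
    fix x y assume "x \<in> carrier (principal_copy f)" "y \<in> carrier (principal_copy f)"
    then show "x \<oplus>\<^bsub>principal_copy f\<^esub> y \<in> carrier (principal_copy f)"
      by (auto simp flip: distrib_left)
  qed (auto simp: ac_simps)
  then show ?thesis
    unfolding right_module_def right_module_axioms_def
    by (auto simp: distrib_left distrib_right mult.assoc)
qed

text \<open>A homomorphism from \<open>f A\<close> is determined by the image of the generator
  \<open>f\<close>. If \<open>m\<close> is a preimage of \<open>k f\<close> under \<open>g\<close>,
  then \<open>x\<close> maps to \<open>m x\<close>, and \<open>f x = x\<close> makes this a lift of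
  \<open>k\<close>.\<close>

lemma projective_principal_copy:
  fixes f :: "'a::{ring,monoid_mult}"
  assumes f: "f * f = f"
  shows "projective_module (principal_copy f)"
  unfolding projective_module_def
proof (intro conjI allI impI, goal_cases)
  case 1
  show ?case by (rule right_module_principal_copy)
next
  case (2 M N g k)
  then have M: "right_module M" and gM: "g \<in> right_module_hom M N"
    and surj: "g ` carrier M = carrier N" and k: "k \<in> right_module_hom (principal_copy f) N"
    by auto
  interpret M: right_module M by fact
  have "f = f * 1" by simp
  then have "to_universe f \<in> carrier (principal_copy f)" by (auto simp del: mult_1_right)
  with k have k_act: "k (act (principal_copy f) (to_universe f) c) = act N (k (to_universe f)) c" for c
    unfolding right_module_hom_def by blast
  from k \<open>to_universe f \<in> _\<close> have "k (to_universe f) \<in> carrier N" by (auto simp: right_module_hom_def)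
  then obtain m where m: "m \<in> carrier M" "g m = k (to_universe f)"
    using surj by (metis imageE)
  let ?h = "\<lambda>x. act M m (of_universe x)"
  have hom: "?h \<in> right_module_hom (principal_copy f) M"
    using m by (auto simp: right_module_hom_def M.act_closed M.act_mult M.act_add_right)
  have "g (?h x) = k x" if x: "x \<in> carrier (principal_copy f)" for x
  proof -
    from x obtain a where a: "x = to_universe (f * a)" by auto
    have "g (?h x) = act N (g m) (of_universe x)"
      using gM m by (auto simp: right_module_hom_def)
    also have "\<dots> = k (act (principal_copy f) (to_universe f) (of_universe x))"
      by (simp only: k_act m(2))
    also have "\<dots> = k x"
      using a f by (simp flip: mult.assoc)
    finally show ?thesis .
  qed
  then show ?case by (intro bexI[OF _ hom] ballI)
qed

text \<open>A direct decomposition of \<open>f A\<close> splits \<open>f\<close> into components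
  \<open>u + v\<close>, which turn out to be orthogonal idempotents. Primitivity kills one of them,
  so one summand contains the generator \<open>f\<close>.\<close>

lemma indecomposable_principal_copy:
  fixes f :: "'a::{ring,monoid_mult}"
  assumes "primitive_idempotent f"
  shows "indecomposable_module (principal_copy f)"
proof -
  have ff: "f * f = f" and f0: "f \<noteq> 0"
    and prim: "\<And>u v. u * u = u \<Longrightarrow> v * v = v \<Longrightarrow> u * v = 0 \<Longrightarrow> v * u = 0 \<Longrightarrow> f = u + v \<Longrightarrow> u = 0 \<or> v = 0"
    using assms by (auto simp: primitive_idempotent_def)
  have "f = f * 1" by simp
  then have f_in: "to_universe f \<in> carrier (principal_copy f)" by (auto simp del: mult_1_right)
  have left: "f * x = x" if "to_universe x \<in> carrier (principal_copy f)" for x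
    using that ff by (auto simp flip: mult.assoc)
  \<comment> \<open>From \<open>u = f u = u u + v u\<close>, the element
    \<open>v u = u - u u\<close> lies in both \<open>N\<close> and \<open>L\<close>, hence
    vanishes.\<close>
  have summand: "v * u = 0 \<and> u * u = u"
    if N: "submodule N (principal_copy f)" and L: "submodule L (principal_copy f)"
      and NL: "N \<inter> L = {to_universe 0}" and u: "to_universe u \<in> N" and v: "to_universe v \<in> L" and uv: "f = u + v"
    for N L u v
  proof -
    note N = submoduleD[OF N, simplified] and L = submoduleD[OF L, simplified]
    have "f * u = u"
      using left u N(1) by (metis principal_copy_simps(1) subsetD)
    then have eq: "v * u = u + u * (- u)"
      using uv by (simp add: algebra_simps)
    have "to_universe (u * (- u)) \<in> N"
      using N(4)[OF u, of "- u"] by simp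
    then have "to_universe (v * u) \<in> N"
      using N(3)[OF u, of "to_universe (u * (- u))"] eq by simp
    moreover have "to_universe (v * u) \<in> L"
      using L(4)[OF v, of u] by simp
    ultimately have "to_universe (v * u) = to_universe 0"
      using NL by blast
    then show ?thesis
      using eq by simp
  qed
  \<comment> \<open>A submodule containing the generator is all of \<open>f A\<close>, so its
    complement is zero.\<close>
  have trivial: "N = {to_universe 0}"
    if N: "submodule N (principal_copy f)" and L: "submodule L (principal_copy f)"
      and NL: "N \<inter> L = {to_universe 0}" and "to_universe f \<in> L" for N L
  proof -
    have "N \<subseteq> L"
    proof
      fix x assume "x \<in> N"
      then have "x \<in> carrier (principal_copy f)"
        using submoduleD(1)[OF N] by blast
      then obtain a where a: "x = to_universe (f * a)" by auto
      then show "x \<in> L"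
        using submoduleD(4)[OF L \<open>to_universe f \<in> L\<close>, of a] by simp
    qed
    then show ?thesis using NL by blast
  qed
  have indec: "N = {to_universe 0} \<or> L = {to_universe 0}"
    if N: "submodule N (principal_copy f)" and L: "submodule L (principal_copy f)"
      and NL: "N \<inter> L = {to_universe 0}"
      and sum: "carrier (principal_copy f) = {x \<oplus>\<^bsub>principal_copy f\<^esub> y |x y. x \<in> N \<and> y \<in> L}" for N L
  proof -
    from f_in obtain x y where "to_universe f = x \<oplus>\<^bsub>principal_copy f\<^esub> y" "x \<in> N" "y \<in> L"
      unfolding sum by blast
    moreover have "x \<in> carrier (principal_copy f)" "y \<in> carrier (principal_copy f)"
      using submoduleD(1)[OF N] submoduleD(1)[OF L] \<open>x \<in> N\<close> \<open>y \<in> L\<close> by blast+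
    then obtain u v where uv: "x = to_universe u" "y = to_universe v"
      by auto
    ultimately have u: "to_universe u \<in> N" and v: "to_universe v \<in> L" and f: "f = u + v"
      by auto
    have LN: "L \<inter> N = {to_universe 0}" and f': "f = v + u"
      using NL f by (auto simp: add.commute)
    note 1 = summand[OF N L NL u v f] and 2 = summand[OF L N LN v u f']
    have "u = 0 \<or> v = 0"
      using prim[of u v] 1 2 f by blast
    then show ?thesis
      using trivial[OF N L NL] trivial[OF L N LN] u v f by auto
  qed
  have nonzero: "carrier (principal_copy f) \<noteq> {to_universe 0}"
  proof -
    have "to_universe f \<notin> {to_universe 0}"
      using f0 by simp
    then show ?thesis using f_in by blast
  qed
  show ?thesis
    unfolding indecomposable_module_def principal_copy_simps(2)
    by (intro conjI allI impI right_module_principal_copy nonzero, elim conjE) (rule indec)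
qed

text \<open>The copy of \<open>f A\<close> is indecomposable projective, hence isomorphic to some
  \<open>e i A\<close>. Take \<open>a\<close> as the image of \<open>f\<close> and \<open>b\<close>
  as the preimage of \<open>e i\<close>: linearity gives \<open>a * b = e i\<close>, and injectivity
  gives \<open>b * a = f\<close>.\<close>

lemma basic_set_iso:
  fixes f :: "'a::{ring,monoid_mult}"
  assumes e: "basic_set e" and f: "primitive_idempotent f"
  obtains i a b where "i \<in> {1..num_simple_modules TYPE('a)}"
    and "e i * a = a" and "a * b = e i" and "b * a = f"
proof -
  let ?I = "{1..num_simple_modules TYPE('a)}"
  have ff: "f * f = f" using f by (simp add: primitive_idempotent_def)
  have "\<exists>i\<in>?I. right_module_iso (principal_copy f) (principal_right_ideal (e i))"
    using e indecomposable_principal_copy[OF f] projective_principal_copy[OF ff]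
    unfolding basic_set_def Let_def by blast
  then obtain i \<phi> where i: "i \<in> ?I"
    and hom: "\<phi> \<in> right_module_hom (principal_copy f) (principal_right_ideal (e i))"
    and bij: "bij_betw \<phi> (to_universe ` range ((*) f)) (range ((*) (e i)))"
    by (auto simp: right_module_iso_def)
  have ee: "e i * e i = e i"
    using e i unfolding basic_set_def primitive_idempotent_def Let_def by blast
  have act: "\<phi> (to_universe (x * a)) = \<phi> (to_universe x) * a" if "x \<in> range ((*) f)" for x a
    using hom that by (auto simp: right_module_hom_def)
  have f_in: "f \<in> range ((*) f)"
    using ff by (metis rangeI)
  define a where "a = \<phi> (to_universe f)"
  have "a \<in> range ((*) (e i))"
    unfolding a_def using bij f_in by (auto simp: bij_betw_def)
  then have ea: "e i * a = a"
    using ee by (auto simp flip: mult.assoc)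
  have "e i \<in> range ((*) (e i))"
    using ee by (metis rangeI)
  then have "e i \<in> \<phi> ` to_universe ` range ((*) f)"
    using bij by (simp add: bij_betw_def)
  then obtain c where c: "e i = \<phi> (to_universe (f * c))"
    by auto
  define b where "b = f * c"
  have b: "b \<in> range ((*) f)" "\<phi> (to_universe b) = e i"
    by (simp_all add: b_def c)
  have fb: "f * b = b"
    using b ff by (auto simp flip: mult.assoc)
  have ab: "a * b = e i"
    using act[OF f_in, of b] fb b by (simp add: a_def)
  have "\<phi> (to_universe (b * a)) = \<phi> (to_universe f)"
    using act[OF b(1), of a] b ea by (simp add: a_def)
  moreover have "b * a \<in> range ((*) f)"
    using fb by (metis mult.assoc rangeI)
  ultimately have "to_universe (b * a) = to_universe f"
    using bij f_in unfolding bij_betw_def by (blast dest: inj_onD)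
  then have "b * a = f" by simp
  with i ea ab show thesis by (rule that)
qed


section \<open>The Jacobson radical\<close>

text \<open>The set is the kernel of \<open>x\<close> \<mapsto> \<open>a x + I\<close> from
  \<open>A\<close> to the simple module \<open>A / I\<close>. A nonzero map to a simple module is
  onto, so its kernel is maximal; the proof does this with elements.\<close>

lemma maximal_right_ideal_quotient:
  fixes I :: "'a::{ring,monoid_mult} set"
  assumes I: "maximal_right_ideal I" and ne: "{x. a * x \<in> I} \<noteq> UNIV"
  shows "maximal_right_ideal {x. a * x \<in> I}"
  unfolding maximal_right_ideal_def
proof (intro conjI allI impI)
  have sub: "0 \<in> I" "\<And>x y. x \<in> I \<Longrightarrow> y \<in> I \<Longrightarrow> x + y \<in> I" "\<And>x c. x \<in> I \<Longrightarrow> x * c \<in> I"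
    using I by (auto simp: maximal_right_ideal_def submodule_regular_iff)
  show "submodule {x. a * x \<in> I} regular_module"
    using sub by (simp add: submodule_regular_iff distrib_left flip: mult.assoc)
  fix J assume J: "submodule J regular_module \<and> {x. a * x \<in> I} \<subseteq> J"
  then have J': "\<And>x y. x \<in> J \<Longrightarrow> y \<in> J \<Longrightarrow> x + y \<in> J" "\<And>x c. x \<in> J \<Longrightarrow> x * c \<in> J"
    by (auto simp: submodule_regular_iff)
  show "J = {x. a * x \<in> I} \<or> J = UNIV"
  proof (rule disjCI)
    assume "J \<noteq> UNIV"
    have "J \<subseteq> {x. a * x \<in> I}"
    proof (rule ccontr)
      assume "\<not> J \<subseteq> {x. a * x \<in> I}"
      then obtain y where y: "y \<in> J" "a * y \<notin> I" by blast
      \<comment> \<open>The right ideal \<open>I + a y A\<close> properly contains \<open>I\<close>,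
        so maximality makes it everything.\<close>
      let ?L = "{u + a * y * c |u c. u \<in> I}"
      have "submodule ?L regular_module"
        unfolding submodule_regular_iff
      proof (intro conjI ballI allI)
        show "0 \<in> ?L"
          using sub(1) by (auto intro!: exI[of _ 0])
      next
        fix x z assume "x \<in> ?L" "z \<in> ?L"
        then obtain u c v d where *: "x = u + a * y * c" "z = v + a * y * d" "u \<in> I" "v \<in> I" by blast
        then have "x + z = (u + v) + a * y * (c + d)"
          by (simp add: algebra_simps)
        then show "x + z \<in> ?L"
          using sub(2)[OF *(3,4)] by blast
      next
        fix x z assume "x \<in> ?L"
        then obtain u c where *: "x = u + a * y * c" "u \<in> I" by blast
        then have "x * z = u * z + a * y * (c * z)"
          by (simp add: algebra_simps)
        then show "x * z \<in> ?L"
          using sub(3)[OF *(2)] by blast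
      qed
      moreover have "I \<subseteq> ?L"
      proof
        fix x assume "x \<in> I"
        moreover have "x = x + a * y * 0" by simp
        ultimately show "x \<in> ?L" by blast
      qed
      moreover have "a * y \<in> ?L"
      proof -
        have "a * y = 0 + a * y * 1" by simp
        then show ?thesis using sub(1) by blast
      qed
      ultimately have "?L = UNIV"
        using I y(2) unfolding maximal_right_ideal_def by blast
      \<comment> \<open>Writing \<open>a = u + a y c\<close> gives \<open>a (1 - y c)\<close> in
        \<open>I\<close>, so \<open>1 - y c\<close> is in \<open>J\<close>; with \<open>y c\<close>
        in \<open>J\<close> this forces \<open>1\<close> into \<open>J\<close>.\<close>
      then have "a \<in> ?L" by blast
      then obtain u c where u: "u \<in> I" "a = u + a * y * c" by blast
      then have "a * (1 + y * (- c)) = u"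
        by (simp add: algebra_simps)
      then have "1 + y * (- c) \<in> J"
        using J u(1) by blast
      then have "1 + y * (- c) + y * c \<in> J"
        using J' y(1) by blast
      then have "1 \<in> J" by simp
      then have "x \<in> J" for x
        using J'(2)[of 1 x] by simp
      then show False using \<open>J \<noteq> UNIV\<close> by blast
    qed
    then show "J = {x. a * x \<in> I}" using J by blast
  qed
qed (rule ne)

text \<open>The radical is an intersection of right ideals, so left multiplication is the side that
  needs an argument: for each maximal \<open>I\<close>, the preimage of \<open>I\<close> under left
  multiplication by \<open>a\<close> is maximal or everything, and contains \<open>x\<close> either
  way.\<close>

lemma jacobson_radical_left_mult:
  fixes x :: "'a::{ring,monoid_mult}"
  assumes "x \<in> jacobson_radical"
  shows "a * x \<in> jacobson_radical"
  unfolding jacobson_radical_def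
proof (intro InterI, clarify)
  fix I :: "'a set" assume I: "maximal_right_ideal I"
  show "a * x \<in> I"
  proof (cases "{x. a * x \<in> I} = UNIV")
    case False
    then show ?thesis
      using maximal_right_ideal_quotient[OF I] assms unfolding jacobson_radical_def by blast
  qed blast
qed


section \<open>Quotient dimensions\<close>

context finite_dimensional_vector_space
begin

text \<open>The span of \<open>B\<close> is a complement of \<open>W\<close> in \<open>V\<close>:
  existence of coefficients gives the sum, uniqueness gives independence and trivial
  intersection.\<close>

lemma quotient_basis_card:
  assumes V: "subspace V" and W: "subspace W" and WV: "W \<subseteq> V" and B: "quotient_basis scale V W B"
  shows "card B + dim W = dim V"
proof -
  have fin: "finite B" and BV: "B \<subseteq> V"
    and ex: "\<And>v. v \<in> V \<Longrightarrow> \<exists>c. v - (\<Sum>b\<in>B. scale (c b) b) \<in> W"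
    and unique: "\<And>c. (\<forall>b. b \<notin> B \<longrightarrow> c b = 0) \<Longrightarrow> (\<Sum>b\<in>B. scale (c b) b) \<in> W \<Longrightarrow> c = (\<lambda>_. 0)"
  proof -
    fix c assume c: "\<forall>b. b \<notin> B \<longrightarrow> c b = 0" "(\<Sum>b\<in>B. scale (c b) b) \<in> W"
    \<comment> \<open>Both \<open>c\<close> and the zero function represent the vector
      \<open>0\<close> modulo \<open>W\<close>.\<close>
    have "\<exists>!c. (\<forall>b. b \<notin> B \<longrightarrow> c b = 0) \<and> 0 - (\<Sum>b\<in>B. scale (c b) b) \<in> W"
      using B subspace_0[OF V] unfolding quotient_basis_def by blast
    then obtain c0 where c0: "\<And>d. (\<forall>b. b \<notin> B \<longrightarrow> d b = 0) \<and> 0 - (\<Sum>b\<in>B. scale (d b) b) \<in> W \<Longrightarrow> d = c0"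
      by (elim ex1E) (rule that, blast)
    have "0 - (\<Sum>b\<in>B. scale (c b) b) \<in> W"
      using subspace_neg[OF W c(2)] by simp
    moreover have "0 - (\<Sum>b\<in>B. scale ((\<lambda>_. 0) b) b) \<in> W"
      using subspace_0[OF W] by simp
    ultimately show "c = (\<lambda>_. 0)"
      using c(1) c0[of c] c0[of "\<lambda>_. 0"] by simp
  qed (use B in \<open>auto simp: quotient_basis_def\<close>)
  have coeff0: "u b = 0" if "(\<Sum>b\<in>B. scale (u b) b) \<in> W" "b \<in> B" for u b
  proof -
    let ?c = "\<lambda>b. if b \<in> B then u b else 0"
    have "(\<Sum>b\<in>B. scale (?c b) b) = (\<Sum>b\<in>B. scale (u b) b)"
      by (rule sum.cong) auto
    then have "?c = (\<lambda>_. 0)"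
      using that(1) by (intro unique) auto
    then show "u b = 0"
      using that(2) by metis
  qed
  have indep: "independent B"
    using coeff0 fin subspace_0[OF W] by (intro independent_if_scalars_zero) auto
  have Int: "span B \<inter> W = {0}"
  proof -
    have "x = 0" if x: "x \<in> span B" "x \<in> W" for x
    proof -
      from x(1) obtain u where "x = (\<Sum>b\<in>B. scale (u b) b)"
        using span_finite[OF fin] by auto
      moreover from this have "u b = 0" if "b \<in> B" for b
        using coeff0 x(2) that by blast
      ultimately show ?thesis by simp
    qed
    then show ?thesis
      using subspace_0[OF W] span_zero by blast
  qed
  have "{x + y |x y. x \<in> span B \<and> y \<in> W} = V"
  proof (intro equalityI subsetI)
    fix x assume "x \<in> {x + y |x y. x \<in> span B \<and> y \<in> W}"
    then show "x \<in> V"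
      using WV span_minimal[OF BV V] subspace_add[OF V] by blast
  next
    fix v assume "v \<in> V"
    from ex[OF this] obtain c where "v - (\<Sum>b\<in>B. scale (c b) b) \<in> W" by blast
    moreover have "(\<Sum>b\<in>B. scale (c b) b) \<in> span B"
      by (intro span_sum span_scale span_base)
    ultimately show "v \<in> {x + y |x y. x \<in> span B \<and> y \<in> W}"
      by (intro CollectI exI[of _ "\<Sum>b\<in>B. scale (c b) b"]
          exI[of _ "v - (\<Sum>b\<in>B. scale (c b) b)"]) auto
  qed
  then show ?thesis
    using dim_sums_Int[OF subspace_span[of B] W] Int indep by (simp add: dim_eq_card_independent)
qed

text \<open>Extend a basis \<open>C\<close> of \<open>W\<close> to a basis \<open>D\<close> of
  \<open>V\<close>; the new vectors \<open>D - C\<close> represent a basis of the quotient.\<close>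

lemma quotient_basis_exists:
  assumes V: "subspace V" and W: "subspace W" and WV: "W \<subseteq> V"
  shows "\<exists>B. quotient_basis scale V W B"
proof -
  obtain C where C: "C \<subseteq> W" "independent C" "W \<subseteq> span C"
    using maximal_independent_subset by blast
  obtain D where D: "C \<subseteq> D" "D \<subseteq> V" "independent D" "V \<subseteq> span D"
    using maximal_independent_subset_extend[of C V] C WV by blast
  have fin: "finite D" using finiteI_independent D(3) by blast
  have spanC: "span C = W" using C W by (meson span_minimal subset_antisym)
  let ?B = "D - C"
  have indep: "u b = 0" if "(\<Sum>b\<in>?B. scale (u b) b) \<in> W" "b \<in> ?B" for u b
  proof -
    from that(1) obtain w where w: "(\<Sum>b\<in>?B. scale (u b) b) = (\<Sum>b\<in>C. scale (w b) b)"
      using span_finite[of C] finite_subset[OF D(1) fin] spanC by auto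
    \<comment> \<open>A combination of \<open>D - C\<close> lying in \<open>W\<close> is also a
      combination of \<open>C\<close>; subtracting gives a linear relation on the independent set
      \<open>D\<close>.\<close>
    let ?c = "\<lambda>b. if b \<in> C then - w b else u b"
    have "(\<Sum>b\<in>D. scale (?c b) b) = (\<Sum>b\<in>?B. scale (?c b) b) + (\<Sum>b\<in>C. scale (?c b) b)"
      by (rule sum.subset_diff[OF D(1) fin])
    also have "(\<Sum>b\<in>?B. scale (?c b) b) = (\<Sum>b\<in>?B. scale (u b) b)"
      by (rule sum.cong) auto
    also have "(\<Sum>b\<in>C. scale (?c b) b) = - (\<Sum>b\<in>C. scale (w b) b)"
      by (simp add: sum_negf)
    finally have "(\<Sum>b\<in>D. scale (?c b) b) = 0"
      using w by simp
    then have "?c b = 0"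
      using D(3) fin that(2) independentD[of D D ?c b] by blast
    then show ?thesis using that(2) by simp
  qed
  have "\<exists>!c. (\<forall>b. b \<notin> ?B \<longrightarrow> c b = 0) \<and> v - (\<Sum>b\<in>?B. scale (c b) b) \<in> W" if "v \<in> V" for v
  proof (rule ex_ex1I)
    from that D(4) obtain u where "v = (\<Sum>b\<in>D. scale (u b) b)"
      using span_finite[OF fin] by auto
    also have "\<dots> = (\<Sum>b\<in>?B. scale (u b) b) + (\<Sum>b\<in>C. scale (u b) b)"
      by (rule sum.subset_diff[OF D(1) fin])
    finally have v: "v - (\<Sum>b\<in>?B. scale (u b) b) = (\<Sum>b\<in>C. scale (u b) b)" by simp
    let ?c = "\<lambda>b. if b \<in> ?B then u b else 0"
    have "(\<Sum>b\<in>?B. scale (?c b) b) = (\<Sum>b\<in>?B. scale (u b) b)"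
      by (rule sum.cong) auto
    moreover have "(\<Sum>b\<in>C. scale (u b) b) \<in> W"
      unfolding spanC[symmetric] by (intro span_sum span_scale span_base)
    ultimately show "\<exists>c. (\<forall>b. b \<notin> ?B \<longrightarrow> c b = 0) \<and> v - (\<Sum>b\<in>?B. scale (c b) b) \<in> W"
      using v by (intro exI[of _ ?c]) auto
  next
    fix c d
    assume c: "(\<forall>b. b \<notin> ?B \<longrightarrow> c b = 0) \<and> v - (\<Sum>b\<in>?B. scale (c b) b) \<in> W"
      and d: "(\<forall>b. b \<notin> ?B \<longrightarrow> d b = 0) \<and> v - (\<Sum>b\<in>?B. scale (d b) b) \<in> W"
    have "(v - (\<Sum>b\<in>?B. scale (d b) b)) - (v - (\<Sum>b\<in>?B. scale (c b) b)) \<in> W"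
      using c d subspace_diff[OF W] by blast
    then have "(\<Sum>b\<in>?B. scale (c b - d b) b) \<in> W"
      by (simp add: scale_left_diff_distrib sum_subtractf)
    then have "c b - d b = 0" if "b \<in> ?B" for b
      using indep[of "\<lambda>b. c b - d b"] that by blast
    then show "c = d"
      using c d by fastforce
  qed
  then show ?thesis
    using fin D(2) by (intro exI[of _ ?B]) (auto simp: quotient_basis_def)
qed

text \<open>Removes the choice of a basis from \<open>quotient_dim\<close>; the additive form avoids
  truncated subtraction on \<open>nat\<close>.\<close>

lemma quotient_dim_eq:
  assumes "subspace V" "subspace W" "W \<subseteq> V"
  shows "quotient_dim scale V W + dim W = dim V"
  unfolding quotient_dim_def
  by (rule quotient_basis_card[OF assms someI_ex[OF quotient_basis_exists[OF assms]]])

end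


section \<open>Ideals modulo commutators\<close>

text \<open>Fixing a basis makes \<open>dim\<close> and the finite-dimensional theory available;
  \<open>fd_algebra\<close> itself only asserts that a finite spanning set exists.\<close>

locale fd_algebra_basis =
  fd_algebra scale + finite_dimensional_vector_space scale Basis
  for scale :: "'f::field \<Rightarrow> 'a::{ring,monoid_mult} \<Rightarrow> 'a" and Basis :: "'a set"
begin

definition alg_ideal :: "'a set \<Rightarrow> bool" where
  "alg_ideal I \<longleftrightarrow> subspace I \<and> (\<forall>x\<in>I. \<forall>a. a * x \<in> I \<and> x * a \<in> I)"

section \<open>Corners and the diagonal projection\<close>

lemma linear_sandwich: "module_hom scale scale (\<lambda>x. a * x * b)"
  by unfold_locales (simp_all add: algebra_simps scale_mult_left scale_mult_right)

lemma subspace_corner: "subspace I \<Longrightarrow> subspace (corner f I)"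
proof -
  assume "subspace I"
  interpret module_hom scale scale "\<lambda>x. f * x * f" by (rule linear_sandwich)
  have "corner f I = (\<lambda>x. f * x * f) ` I"
    by (auto simp: corner_def)
  then show ?thesis
    using subspace_image[OF \<open>subspace I\<close>] by simp
qed

text \<open>The map \<pi> of the opening comment, over an arbitrary index set so that dimensions can
  be computed by induction on \<open>S\<close>.\<close>

definition diag_part :: "(nat \<Rightarrow> 'a) \<Rightarrow> nat set \<Rightarrow> 'a \<Rightarrow> 'a" where
  "diag_part e S x = (\<Sum>i\<in>S. e i * x * e i)"

lemma subspace_diag_part:
  assumes "subspace I"
  shows "subspace (diag_part e S ` I)"
proof -
  interpret module_hom scale scale "diag_part e S"
    by unfold_locales
      (simp_all add: diag_part_def algebra_simps scale_mult_left scale_mult_right sum.distrib scale_sum_right)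
  show ?thesis by (rule subspace_image[OF assms])
qed

lemma diag_part_mem: "alg_ideal I \<Longrightarrow> x \<in> I \<Longrightarrow> diag_part e S x \<in> I"
  unfolding diag_part_def alg_ideal_def by (intro subspace_sum) auto

lemma diag_part_orthogonal:
  assumes "\<And>i. i \<in> S \<Longrightarrow> a * e i = 0"
  shows "a * diag_part e S x = 0"
  unfolding diag_part_def sum_distrib_left
  by (rule sum.neutral) (simp add: assms flip: mult.assoc)

lemma diag_part_component:
  assumes "finite S" "i \<in> S" "\<And>i j. i \<in> S \<Longrightarrow> j \<in> S \<Longrightarrow> i \<noteq> j \<Longrightarrow> e i * e j = 0"
    and "\<And>i. i \<in> S \<Longrightarrow> e i * e i = e i"
  shows "e i * diag_part e S x * e i = e i * x * e i"
proof -
  have "diag_part e S x = e i * x * e i + diag_part e (S - {i}) x"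
    using assms(1,2) by (simp add: diag_part_def sum.remove)
  moreover have "e i * diag_part e (S - {i}) x = 0"
    by (rule diag_part_orthogonal) (use assms(2,3) in auto)
  ultimately show ?thesis
    using assms(4)[OF assms(2)] by (simp add: distrib_left mult.assoc) (simp add: flip: mult.assoc)
qed

lemma diag_part_idem:
  assumes "finite S" "\<And>i j. i \<in> S \<Longrightarrow> j \<in> S \<Longrightarrow> i \<noteq> j \<Longrightarrow> e i * e j = 0"
    and "\<And>i. i \<in> S \<Longrightarrow> e i * e i = e i"
  shows "diag_part e S (diag_part e S x) = diag_part e S x"
proof -
  have "diag_part e S (diag_part e S x) = (\<Sum>i\<in>S. e i * diag_part e S x * e i)"
    by (simp only: diag_part_def)
  also have "\<dots> = (\<Sum>i\<in>S. e i * x * e i)"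
    by (rule sum.cong[OF refl], rule diag_part_component) (use assms in auto)
  finally show ?thesis by (simp add: diag_part_def)
qed

text \<open>The image is the direct sum of the corners of \<open>I\<close>; inserting an index
  \<open>j\<close> adds one corner that meets the previous sum only in \<open>0\<close>.\<close>

lemma dim_diag_part:
  assumes I: "alg_ideal I" and "finite S"
    and "\<And>i j. i \<in> S \<Longrightarrow> j \<in> S \<Longrightarrow> i \<noteq> j \<Longrightarrow> e i * e j = 0"
    and "\<And>i. i \<in> S \<Longrightarrow> e i * e i = e i"
  shows "dim (diag_part e S ` I) = (\<Sum>i\<in>S. dim (corner (e i) I))"
  using assms(2-)
proof (induction S)
  case empty
  then show ?case by (auto simp: diag_part_def)
next
  case (insert j S)
  have I': "subspace I" using I by (simp add: alg_ideal_def)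
  have "diag_part e (insert j S) ` I =
      {x + y |x y. x \<in> corner (e j) I \<and> y \<in> diag_part e S ` I}" (is "_ = ?R")
  proof (intro equalityI subsetI)
    fix x assume "x \<in> diag_part e (insert j S) ` I"
    then show "x \<in> ?R"
      using insert.hyps by (auto simp: diag_part_def corner_def)
  next
    fix z assume "z \<in> ?R"
    then obtain x y where xy: "x \<in> I" "y \<in> I" "z = e j * x * e j + diag_part e S y"
      by (auto simp: corner_def)
    \<comment> \<open>The sum is its own preimage: it stays in the ideal, and orthogonality lets the
      enlarged projection fix it.\<close>
    let ?w = "e j * x * e j + diag_part e S y"
    have "?w \<in> I"
      using xy(1) I diag_part_mem[OF I xy(2)] by (auto simp: alg_ideal_def intro!: subspace_add)
    moreover have "diag_part e (insert j S) ?w = z"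
    proof -
      have "e j * diag_part e S y = 0"
        by (rule diag_part_orthogonal) (use insert.hyps insert.prems(1)[of j] in auto)
      moreover have "e j * e j = e j" using insert.prems by blast
      ultimately have "e j * ?w * e j = e j * x * e j"
        by (simp add: distrib_left mult.assoc) (simp add: flip: mult.assoc)
      moreover have "e i * ?w * e i = e i * y * e i" if "i \<in> S" for i
      proof -
        have "i \<noteq> j" using that insert.hyps by blast
        then have "e i * e j = 0" using insert.prems(1) that by blast
        then have "e i * (e j * x * e j) = 0" by (simp flip: mult.assoc)
        moreover have "e i * diag_part e S y * e i = e i * y * e i"
          by (rule diag_part_component) (use insert that in auto)
        ultimately show ?thesis by (simp add: distrib_left)
      qed
      ultimately show ?thesis
        using insert.hyps xy(3) by (simp add: diag_part_def)
    qed
    ultimately show "z \<in> diag_part e (insert j S) ` I" by (metis imageI)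
  qed
  moreover have "corner (e j) I \<inter> diag_part e S ` I = {0}"
  proof -
    \<comment> \<open>Left multiplication by \<open>e j\<close> fixes the corner and annihilates the
      sum of the other corners.\<close>
    have "z = 0" if "z = e j * x * e j" "z = diag_part e S y" for x y z
    proof -
      have "e j * diag_part e S y = 0"
        by (rule diag_part_orthogonal) (use insert.hyps insert.prems(1)[of j] in auto)
      moreover have "e j * z = z"
        using that(1) insert.prems(2)[of j] by (simp flip: mult.assoc)
      ultimately show ?thesis using that(2) by simp
    qed
    then show ?thesis
      using subspace_0[OF subspace_corner[OF I', of "e j"]] subspace_0[OF subspace_diag_part[OF I', of e S]]
      by (auto simp: corner_def)
  qed
  ultimately show ?case
    using insert dim_sums_Int[OF subspace_corner[OF I', of "e j"] subspace_diag_part[OF I', of e S]]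
    by simp
qed

section \<open>Decomposing ideals into commutators and diagonal parts\<close>

lemma subspace_commutator_space: "subspace (commutator_space scale)"
  by (simp add: commutator_space_def)

lemma commutator_mem: "x * y - y * x \<in> commutator_space scale"
  unfolding commutator_space_def by (rule span_base) blast

text \<open>
  Splitting \<open>f\<close> along its non-primitive decompositions avoids writing \<open>1\<close> as a sum of primitive
  idempotents.
\<close>

lemma idempotent_corner_decomp:
  assumes e: "basic_set e" and I: "alg_ideal I" and "f * f = f" and "x \<in> I"
  shows "f * x * f \<in> {k + c |k c. k \<in> commutator_space scale \<and>
    c \<in> diag_part e {1..num_simple_modules TYPE('a)} ` I}"
  using assms(3,4)
proof (induction "dim (range ((*) f))" arbitrary: f x rule: less_induct)
  case less
  let ?I = "{1..num_simple_modules TYPE('a)}"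
  let ?K = "commutator_space scale" and ?C = "diag_part e ?I ` I"
  let ?S = "{k + c |k c. k \<in> ?K \<and> c \<in> ?C}"
  have subI: "subspace I" using I by (simp add: alg_ideal_def)
  have sub: "subspace ?S"
    by (rule subspace_sums[OF subspace_commutator_space subspace_diag_part[OF subI]])
  have K: "?K \<subseteq> ?S"
    using subspace_0[OF subspace_diag_part[OF subI, of e ?I]] by force
  have C: "?C \<subseteq> ?S"
    using subspace_0[OF subspace_commutator_space] by force
  have ff: "f * f = f" and xI: "x \<in> I" by fact+
  consider "f = 0" | "primitive_idempotent f"
    | g h where "g * g = g" "h * h = h" "g * h = 0" "h * g = 0" "f = g + h" "g \<noteq> 0" "h \<noteq> 0"
    using ff unfolding primitive_idempotent_def by blast
  then show ?case
  proof cases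
    case 1
    then show ?thesis using subspace_0[OF sub] by simp
  next
    case 2
    from basic_set_iso[OF e 2] obtain i a b where i: "i \<in> ?I"
      and ea: "e i * a = a" and ab: "a * b = e i" and ba: "b * a = f" .
    have ee: "e i * e i = e i" and orth: "\<And>j. j \<in> ?I \<Longrightarrow> j \<noteq> i \<Longrightarrow> e j * e i = 0"
      using e i unfolding basic_set_def primitive_idempotent_def Let_def by blast+
    have bfb: "f * b = b * e i"
      using ab ba by (metis mult.assoc)
    \<comment> \<open>Since \<open>f x f = b (a x f)\<close>, swapping the factors changes it by a
      commutator and yields \<open>?y\<close>. By \<open>f b = b (e i)\<close> this lies in the
      corner of \<open>e i\<close>, so the projection fixes it.\<close>
    let ?y = "a * x * f * b"
    have "?y = e i * ?y * e i"
      using ea bfb ee by (metis mult.assoc)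
    also have "\<dots> = diag_part e ?I (e i * ?y * e i)"
    proof -
      have "diag_part e ?I (e i * ?y * e i) = (\<Sum>j\<in>?I. if j = i then e i * ?y * e i else 0)"
        unfolding diag_part_def
      proof (rule sum.cong[OF refl])
        fix j assume "j \<in> ?I"
        show "e j * (e i * ?y * e i) * e j = (if j = i then e i * ?y * e i else 0)"
        proof (cases "j = i")
          case True
          then show ?thesis using ee by (metis mult.assoc)
        next
          case False
          then show ?thesis using orth[OF \<open>j \<in> ?I\<close>] by (simp flip: mult.assoc)
        qed
      qed
      then show ?thesis using i by simp
    qed
    finally have "?y \<in> ?C"
      using I xI unfolding alg_ideal_def by (metis imageI)
    moreover have "f * x * f = (b * (a * x * f) - (a * x * f) * b) + ?y"
      using ba by (simp add: mult.assoc[symmetric])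
    ultimately show ?thesis
      using commutator_mem by blast
  next
    case 3
    \<comment> \<open>The induction measure drops: \<open>h = f h\<close> lies in
      \<open>f A\<close>, but not in \<open>g A\<close>, whose elements \<open>g\<close> fixes,
      because \<open>g h = 0\<close> and \<open>h\<close> is nonzero.\<close>
    have smaller: "dim (range ((*) g)) < dim (range ((*) f))"
      if "f = g + h" "g * g = g" "h * h = h" "g * h = 0" "h * g = 0" "h \<noteq> 0" for g h
    proof -
      have ss: "subspace (range ((*) u))" for u
        by (rule subspaceI)
          (auto simp: scale_mult_right[symmetric] distrib_left[symmetric] intro: image_eqI[of _ _ 0])
      have "g * x = f * (g * x)" for x
        using that by (simp add: distrib_right flip: mult.assoc)
      then have "range ((*) g) \<subseteq> range ((*) f)" by blast
      moreover have "h \<in> range ((*) f)"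
        using that by (metis add_0 distrib_right rangeI)
      moreover have "h \<notin> range ((*) g)"
        using that by (metis (no_types, opaque_lifting) imageE mult.assoc)
      ultimately have "range ((*) g) \<subset> range ((*) f)" by blast
      then show ?thesis
        using dim_psubset ss by (metis span_eq_iff)
    qed
    have "g * x * g \<in> ?S"
      using less.hyps[OF smaller[of g h]] 3 xI by auto
    moreover have "h * x * h \<in> ?S"
      using less.hyps[OF smaller[of h g]] 3 xI by (auto simp: add.commute)
    \<comment> \<open>The subtracted products vanish because \<open>h g = g h = 0\<close>, so these
      commutators are the off-diagonal pieces \<open>g x h\<close> and \<open>h x g\<close>.\<close>
    moreover have "g * (x * h) - (x * h) * g \<in> ?S" "h * (x * g) - (x * g) * h \<in> ?S"
      using K commutator_mem by blast+
    moreover have "f * x * f = g * x * g + h * x * h + (g * (x * h) - (x * h) * g)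
        + (h * (x * g) - (x * g) * h)"
      using 3 by (simp add: algebra_simps)
    ultimately show ?thesis
      using subspace_add[OF sub] by presburger
  qed
qed

lemma alg_ideal_decomp:
  assumes "basic_set e" "alg_ideal I" "x \<in> I"
  obtains k y where "k \<in> commutator_space scale" "y \<in> I"
    "x = k + diag_part e {1..num_simple_modules TYPE('a)} y"
proof -
  have "x \<in> {k + c |k c. k \<in> commutator_space scale \<and>
      c \<in> diag_part e {1..num_simple_modules TYPE('a)} ` I}"
    using idempotent_corner_decomp[OF assms(1,2) _ assms(3), of 1] by simp
  then show thesis using that by blast
qed


section \<open>Radical powers and the dimension count\<close>

lemma alg_ideal_UNIV: "alg_ideal UNIV"
  by (simp add: alg_ideal_def)

text \<open>On a generator \<open>x y\<close>, a left factor is absorbed by \<open>x\<close> in the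
  radical and a right factor by \<open>y\<close> in the preceding power.\<close>

lemma alg_ideal_radical_power: "alg_ideal (radical_power scale n)"
proof (induction n)
  case (Suc n)
  let ?G = "{x * y |x y. x \<in> jacobson_radical \<and> y \<in> radical_power scale n}"
  have "a * x \<in> span ?G \<and> x * a \<in> span ?G" if "x \<in> span ?G" for a x
    using that
  proof (induction rule: span_induct_alt)
    case base
    show ?case by (simp add: span_zero)
  next
    case (step c z w)
    then obtain x y where z: "z = x * y" "x \<in> jacobson_radical" "y \<in> radical_power scale n"
      by blast
    have "a * z \<in> ?G" "z * a \<in> ?G"
      using z jacobson_radical_left_mult Suc.IH unfolding alg_ideal_def
      by (metis (mono_tags, lifting) mem_Collect_eq mult.assoc)+
    then show ?case
      using step by (auto simp: distrib_left distrib_right scale_mult_left scale_mult_right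
          intro!: span_add span_scale intro: span_base)
  qed
  then show ?case
    by (auto simp: alg_ideal_def)
qed (simp add: alg_ideal_UNIV)

lemma radical_power_antimono:
  assumes "m \<le> n"
  shows "radical_power scale n \<subseteq> radical_power scale m"
  using assms
proof (induction rule: dec_induct)
  case (step n)
  have "radical_power scale (Suc n) \<subseteq> radical_power scale n"
    using alg_ideal_radical_power[of n] unfolding alg_ideal_def radical_power.simps
    by (intro span_minimal) auto
  then show ?case using step by blast
qed simp

section \<open>Dimension count for a fixed basic set\<close>

context
  fixes e :: "nat \<Rightarrow> 'a" and idx :: "nat set"
  assumes e: "basic_set e" and idx: "idx = {1..num_simple_modules TYPE('a)}"
begin

lemma finite_idx: "finite idx"
  by (simp add: idx)

lemma basic_set_orthogonal: "i \<in> idx \<Longrightarrow> j \<in> idx \<Longrightarrow> i \<noteq> j \<Longrightarrow> e i * e j = 0"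
  using e unfolding basic_set_def Let_def idx by blast

lemma basic_set_idempotent: "i \<in> idx \<Longrightarrow> e i * e i = e i"
  using e unfolding basic_set_def Let_def primitive_idempotent_def idx by blast

text \<open>Summing \<open>dim\<close> over the corners of \<open>A\<close> and of the radical power
  gives the dimensions of their images under \<pi>.\<close>

lemma corner_dim_sum_eq:
  "corner_dim_sum scale e n + dim (diag_part e idx ` radical_power scale n) = dim (range (diag_part e idx))"
proof -
  have "quotient_dim scale (corner (e i) UNIV) (corner (e i) (radical_power scale n))
      + dim (corner (e i) (radical_power scale n)) = dim (corner (e i) UNIV)" for i
  proof (rule quotient_dim_eq)
    show "subspace (corner (e i) (radical_power scale n))"
      using alg_ideal_radical_power[of n] by (simp add: subspace_corner alg_ideal_def)
  qed (simp_all add: subspace_corner, auto simp: corner_def)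
  then have "corner_dim_sum scale e n + (\<Sum>i\<in>idx. dim (corner (e i) (radical_power scale n)))
      = (\<Sum>i\<in>idx. dim (corner (e i) UNIV))"
    by (simp add: corner_dim_sum_def idx flip: sum.distrib)
  then show ?thesis
    using dim_diag_part[OF alg_ideal_radical_power[of n], of idx e]
      dim_diag_part[OF alg_ideal_UNIV, of idx e] basic_set_orthogonal basic_set_idempotent finite_idx
    by simp
qed

lemma subspace_KR: "subspace (KR scale n)"
  unfolding KR_def using alg_ideal_radical_power[of n]
  by (intro subspace_sums subspace_commutator_space) (simp add: alg_ideal_def)

text \<open>Commutators and the range of \<pi> together span \<open>A\<close>, so the codimension of
  \<open>KR scale n\<close> can be measured inside that range.\<close>

lemma codim_KR_eq:
  "codim scale (KR scale n) + dim (KR scale n \<inter> range (diag_part e idx)) = dim (range (diag_part e idx))"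
proof -
  have rad0: "0 \<in> radical_power scale n"
    using alg_ideal_radical_power[of n] subspace_0 unfolding alg_ideal_def by blast
  have "{x + y |x y. x \<in> KR scale n \<and> y \<in> range (diag_part e idx)} = UNIV"
  proof (intro equalityI subsetI)
    fix x :: 'a
    obtain k y where ky: "k \<in> commutator_space scale" "x = k + diag_part e idx y"
      using alg_ideal_decomp[OF e alg_ideal_UNIV, of x] by (auto simp: idx)
    then have "k \<in> KR scale n"
      using rad0 unfolding KR_def by force
    then show "x \<in> {x + y |x y. x \<in> KR scale n \<and> y \<in> range (diag_part e idx)}"
      using ky(2) by blast
  qed simp
  then have "dim (UNIV :: 'a set) + dim (KR scale n \<inter> range (diag_part e idx))
      = dim (KR scale n) + dim (range (diag_part e idx))"
    using dim_sums_Int[OF subspace_KR[of n] subspace_diag_part[OF subspace_UNIV, of e idx]]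
    by simp
  moreover have "codim scale (KR scale n) + dim (KR scale n) = dim (UNIV :: 'a set)"
    unfolding codim_def by (rule quotient_dim_eq) (simp_all add: subspace_KR)
  ultimately show ?thesis by simp
qed

lemma diag_part_radical_power_subset:
  "diag_part e idx ` radical_power scale n \<subseteq> KR scale n \<inter> range (diag_part e idx)"
proof
  fix x assume "x \<in> diag_part e idx ` radical_power scale n"
  moreover from this have "x \<in> radical_power scale n"
    using diag_part_mem[OF alg_ideal_radical_power] by blast
  moreover have "x = 0 + x" by simp
  ultimately show "x \<in> KR scale n \<inter> range (diag_part e idx)"
    unfolding KR_def using subspace_0[OF subspace_commutator_space] by blast
qed

lemma codim_KR_le: "codim scale (KR scale n) \<le> corner_dim_sum scale e n"
  using dim_subset[OF diag_part_radical_power_subset[of n]] corner_dim_sum_eq[of n] codim_KR_eq[of n]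
  by linarith

text \<open>Equality of the counts means that two nested subspaces coincide. The resulting inclusion
  mentions no dimensions, so it can be compared between different exponents.\<close>

lemma codim_KR_eq_iff:
  "codim scale (KR scale n) = corner_dim_sum scale e n \<longleftrightarrow>
    KR scale n \<inter> range (diag_part e idx) \<subseteq> radical_power scale n"
proof -
  let ?C = "range (diag_part e idx)" and ?Cn = "diag_part e idx ` radical_power scale n"
  have "codim scale (KR scale n) = corner_dim_sum scale e n \<longleftrightarrow> dim (KR scale n \<inter> ?C) = dim ?Cn"
    using corner_dim_sum_eq[of n] codim_KR_eq[of n] by linarith
  also have "\<dots> \<longleftrightarrow> ?Cn = KR scale n \<inter> ?C"
  proof
    assume "dim (KR scale n \<inter> ?C) = dim ?Cn"
    then show "?Cn = KR scale n \<inter> ?C"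
      using alg_ideal_radical_power[of n] diag_part_radical_power_subset[of n]
      by (intro subspace_dim_equal subspace_diag_part subspace_inter subspace_KR)
        (simp_all add: alg_ideal_def)
  qed simp
  also have "\<dots> \<longleftrightarrow> KR scale n \<inter> ?C \<subseteq> radical_power scale n"
  proof
    assume "?Cn = KR scale n \<inter> ?C"
    moreover have "?Cn \<subseteq> radical_power scale n"
      using diag_part_mem[OF alg_ideal_radical_power[of n]] by (rule image_subsetI)
    ultimately show "KR scale n \<inter> ?C \<subseteq> radical_power scale n" by simp
  next
    assume sub: "KR scale n \<inter> ?C \<subseteq> radical_power scale n"
    have "x \<in> ?Cn" if "x \<in> KR scale n \<inter> ?C" for x
    proof -
      \<comment> \<open>Elements in the range of \<pi> are fixed by \<pi>, so such an element of the
        radical power is the image of itself.\<close>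
      have "diag_part e idx (diag_part e idx y) = diag_part e idx y" for y
        by (rule diag_part_idem) (simp_all add: finite_idx basic_set_orthogonal basic_set_idempotent)
      then have "x = diag_part e idx x"
        using that by fastforce
      then show ?thesis using sub that by blast
    qed
    then show "?Cn = KR scale n \<inter> ?C"
      by (intro equalityI diag_part_radical_power_subset subsetI)
  qed
  finally show ?thesis .
qed

lemma codim_KR_eq_antimono:
  assumes "m \<le> n" and "codim scale (KR scale n) = corner_dim_sum scale e n"
  shows "codim scale (KR scale m) = corner_dim_sum scale e m"
  unfolding codim_KR_eq_iff
proof
  let ?K = "commutator_space scale"
  fix x assume x: "x \<in> KR scale m \<inter> range (diag_part e idx)"
  then obtain k r z where k: "k \<in> ?K" and r: "r \<in> radical_power scale m"
    and xkr: "x = k + r" and z: "x = diag_part e idx z"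
    by (auto simp: KR_def)
  obtain k' y where k': "k' \<in> ?K" and y: "y \<in> radical_power scale m"
    and rk: "r = k' + diag_part e idx y"
    using alg_ideal_decomp[OF e alg_ideal_radical_power r] unfolding idx .
  \<comment> \<open>The radical part of \<open>x\<close> has been traded for commutators:
    \<open>?d\<close> is in the commutator space, hence in \<open>KR scale n\<close>, and the
    criterion for \<open>n\<close> applies to it.\<close>
  let ?d = "x - diag_part e idx y"
  have "?d = k + k'"
    using xkr rk by simp
  then have "?d \<in> ?K"
    using subspace_add[OF subspace_commutator_space k k'] by simp
  moreover have "0 \<in> radical_power scale n"
    using alg_ideal_radical_power[of n] subspace_0 unfolding alg_ideal_def by blast
  ultimately have "?d \<in> KR scale n"
    unfolding KR_def by force
  moreover have "?d \<in> range (diag_part e idx)"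
    unfolding z by (intro subspace_diff subspace_diag_part) auto
  ultimately have "?d \<in> radical_power scale m"
    using assms codim_KR_eq_iff radical_power_antimono by blast
  moreover have "diag_part e idx y \<in> radical_power scale m"
    using diag_part_mem[OF alg_ideal_radical_power y] .
  ultimately have "?d + diag_part e idx y \<in> radical_power scale m"
    using alg_ideal_radical_power[of m] unfolding alg_ideal_def by (blast intro: subspace_add)
  then show "x \<in> radical_power scale m" by simp
qed

end

end

lemma (in fd_algebra) fd_algebra_basis_exists: "\<exists>B. fd_algebra_basis scale B"
proof -
  obtain S where S: "finite S" "span S = UNIV"
    using finite_dimensional by metis
  obtain B where B: "B \<subseteq> S" "independent B" "S \<subseteq> span B"
    by (rule maximal_independent_subset)
  have "span B = UNIV"
    using S(2) span_minimal[OF B(3) subspace_span] by (simp add: top.extremum_unique)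
  then have "finite_dimensional_vector_space scale B"
    using B finite_subset[OF B(1) S(1)] by unfold_locales auto
  then show ?thesis
    using fd_algebra_axioms unfolding fd_algebra_basis_def by blast
qed

theorem theorem3p4:
  fixes scale :: "'f::field \<Rightarrow> 'a::{ring,monoid_mult} \<Rightarrow> 'a"
    and e :: "nat \<Rightarrow> 'a"
  assumes "fd_algebra scale"
    and "basic_set e"
  shows "(\<forall>n\<ge>1. codim scale (KR scale n) \<le> corner_dim_sum scale e n) \<and>
    (\<forall>n\<ge>1. codim scale (KR scale n) = corner_dim_sum scale e n \<longrightarrow>
       (\<forall>m. 1 \<le> m \<and> m \<le> n \<longrightarrow> codim scale (KR scale m) = corner_dim_sum scale e m)) \<and>
    (\<forall>n\<ge>1. codim scale (KR scale n) \<noteq> corner_dim_sum scale e n \<longrightarrow>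
       (\<forall>m\<ge>n. codim scale (KR scale m) \<noteq> corner_dim_sum scale e m))"
proof -
  obtain B where "fd_algebra_basis scale B"
    using fd_algebra.fd_algebra_basis_exists[OF assms(1)] by blast
  then interpret fd_algebra_basis scale B .
  \<comment> \<open>The third claim is the contrapositive of the second: equality at
    \<open>m\<close> would descend to \<open>n\<close>.\<close>
  show ?thesis
    using codim_KR_le[OF assms(2) refl] codim_KR_eq_antimono[OF assms(2) refl] by blast
qed

end
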